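(* Let $r,b,d\ge 1$ be integers, let $t\ge 2$ be an integer, and suppose $m=b(t-1)-r\ge 0$. Let $a=\lfloor m/d\rfloor$. Then $$\mathbf{P}(S_{r,b}>(t-1)/t)=\sum_{n=0}^\infty \frac{a+1}{n(t-1)+a+1}\binom{nt+a}{n}\frac{B(n(t-1)+a+1+(r/d),\,n+(b/d))}{B(r/d,\,b/d)}.$$
   Context: P\'olya's urn with integer parameters $r,b,d\ge 1$: the urn initially contains $r$ red and $b$ black balls. In each draw one ball is taken uniformly at random from the urn, and this ball together with another $d$ balls of the same color is put into the urn. $R_n$ is the number of red balls in the urn after the $n$th draw ($R_0=r$), $Z_n=R_n/(nd+r+b)$, and $S_{r,b}=\sup_{n\ge 0}Z_n$. $B(\alpha,\beta)$ is the Beta function. *)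

theory Defs
  imports "HOL-Probability.Probability"
begin

text \<open>The evolution of the urn along one sequence of draws: \<open>c n\<close> says whether the \<open>n + 1\<close>-st ball
  drawn is red.\<close>

primrec urn_red :: "nat \<Rightarrow> nat \<Rightarrow> (nat \<Rightarrow> bool) \<Rightarrow> nat \<Rightarrow> nat" where
  "urn_red r d c 0 = r"
| "urn_red r d c (Suc n) = urn_red r d c n + (if c n then d else 0)"

primrec urn_black :: "nat \<Rightarrow> nat \<Rightarrow> (nat \<Rightarrow> bool) \<Rightarrow> nat \<Rightarrow> nat" where
  "urn_black b d c 0 = b"
| "urn_black b d c (Suc n) = urn_black b d c n + (if c n then 0 else d)"

text \<open>The colour process \<open>C\<close> of a P\'olya urn, on an arbitrary probability space. Drawing uniformly
  from the current urn means that, given the colours \<open>c 0, \<dots>, c (n - 1)\<close> drawn so far, the next ball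
  is red with probability equal to the current proportion of red balls. The restriction to histories
  of positive probability is needed because \<open>cond_prob\<close> is \<open>0\<close> for null events.\<close>

locale polya_urn = prob_space M
  for M :: "'a measure" and C :: "nat \<Rightarrow> 'a \<Rightarrow> bool" and r b d :: nat +
  assumes measurable_colour: "\<And>n. C n \<in> measurable M (count_space UNIV)"
    and uniform_draw: "\<And>n c. \<P>(\<omega> in M. \<forall>i<n. C i \<omega> = c i) > 0 \<Longrightarrow>
      \<P>(\<omega> in M. C n \<omega> \<bar> \<forall>i<n. C i \<omega> = c i) =
        real (urn_red r d c n) / real (urn_red r d c n + urn_black b d c n)"

definition urn_R :: "nat \<Rightarrow> nat \<Rightarrow> (nat \<Rightarrow> 'a \<Rightarrow> bool) \<Rightarrow> nat \<Rightarrow> 'a \<Rightarrow> nat" where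
  "urn_R r d C n \<omega> = urn_red r d (\<lambda>i. C i \<omega>) n"

definition urn_Z :: "nat \<Rightarrow> nat \<Rightarrow> nat \<Rightarrow> (nat \<Rightarrow> 'a \<Rightarrow> bool) \<Rightarrow> nat \<Rightarrow> 'a \<Rightarrow> real" where
  "urn_Z r b d C n \<omega> = real (urn_R r d C n \<omega>) / real (n * d + r + b)"

text \<open>The real-valued supremum is genuine, since \<open>urn_Z\<close> takes values in \<open>[0, 1]\<close>.\<close>

definition urn_S :: "nat \<Rightarrow> nat \<Rightarrow> nat \<Rightarrow> (nat \<Rightarrow> 'a \<Rightarrow> bool) \<Rightarrow> 'a \<Rightarrow> real" where
  "urn_S r b d C \<omega> = (SUP n. urn_Z r b d C n \<omega>)"

end

theory Submission
  imports Defs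
begin

text \<open>
  After \<open>k\<close> red and \<open>j\<close> black draws the proportion of red balls exceeds \<open>(t - 1) / t\<close> iff
  \<open>r + d * k > (t - 1) * (b + d * j)\<close>, that is, iff \<open>k - (t - 1) * j > m / d\<close>. The left-hand side is an
  integer, so this says \<open>k - (t - 1) * j \<ge> a + 1\<close>. The supremum therefore exceeds \<open>(t - 1) / t\<close> iff the
  walk that moves up by \<open>1\<close> at a red draw and down by \<open>t - 1\<close> at a black draw ever reaches the height
  \<open>a + 1\<close>. Its upward steps have size \<open>1\<close>, so it cannot jump over that height: at the first passage
  it is exactly there, and if \<open>n\<close> black balls have been drawn by then, the number of red draws is
  \<open>n * (t - 1) + a + 1\<close>.

  The events that the first passage happens after exactly \<open>n\<close> black draws are disjoint, and each of
  them is a finite disjoint union of cylinders, one for each first passage path. The draws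
  are exchangeable: the probability of a cylinder depends only on the numbers of red and
  black draws and is a quotient of Beta values (\<open>prob_history_eq_Beta_quotient\<close>).
  So the \<open>n\<close>-th summand is this quotient times the number of first passage paths, a number
  given by the hitting time theorem for walks (\<open>card_first_passage_paths\<close>).
\<close>

section \<open>First passage paths\<close>

text \<open>The argument \<open>s\<close> is the height that is still to be climbed, and the letter \<open>False\<close> is a
  downward step of size \<open>u\<close>. Measuring from the target keeps all heights natural numbers, because a
  path stops as soon as the remaining height is \<open>0\<close>.\<close>

fun first_passage :: "nat \<Rightarrow> nat \<Rightarrow> bool list \<Rightarrow> bool" where
  "first_passage u s [] \<longleftrightarrow> s = 0"
| "first_passage u s (x # xs) \<longleftrightarrow> s > 0 \<and> first_passage u (if x then s - 1 else s + u) xs"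

definition first_passage_paths :: "nat \<Rightarrow> nat \<Rightarrow> nat \<Rightarrow> bool list set" where
  "first_passage_paths u s n = {xs. first_passage u s xs \<and> count_list xs False = n}"

lemma first_passage_count_True:
  "first_passage u s xs \<Longrightarrow> count_list xs True = s + u * count_list xs False"
  by (induction xs arbitrary: s) (auto split: if_splits)

lemma length_eq_count_True_False: "length xs = count_list xs True + count_list xs False"
  by (induction xs) auto

text \<open>Only a step of size \<open>1\<close> can reach the target from below, so a path that ends at or above the
  target has a prefix that ends exactly there for the first time.\<close>

lemma first_passage_prefix_exists:
  assumes "s + u * count_list xs False \<le> count_list xs True"
  shows "\<exists>k\<le>length xs. first_passage u s (take k xs)"
  using assms
proof (induction xs arbitrary: s)
  case Nil
  then show ?case by simp
next
  case (Cons x xs)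
  show ?case
  proof (cases "s = 0")
    case True
    then show ?thesis by (intro exI[of _ 0]) simp
  next
    case False
    let ?s = "if x then s - 1 else s + u"
    have "?s + u * count_list xs False \<le> count_list xs True"
      using Cons.prems False by (cases x) (auto simp: algebra_simps)
    from Cons.IH[OF this] obtain k where "k \<le> length xs" "first_passage u ?s (take k xs)"
      by blast
    then show ?thesis
      using False by (intro exI[of _ "Suc k"]) auto
  qed
qed

text \<open>First passage paths form a prefix code, which makes the corresponding cylinders disjoint.\<close>

lemma first_passage_append_imp_Nil:
  "first_passage u s xs \<Longrightarrow> first_passage u s (xs @ ys) \<Longrightarrow> ys = []"
proof (induction xs arbitrary: s)
  case Nil
  then show ?case by (cases ys) auto
qed auto

lemma first_passage_along_sequence_unique:
  assumes "first_passage u s (map c [0..<k])" "first_passage u s (map c [0..<l])"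
  shows "k = l"
proof -
  have "k = l" if "k \<le> l" "first_passage u s (map c [0..<k])" "first_passage u s (map c [0..<l])"
    for k l
  proof -
    have "map c [0..<l] = map c [0..<k] @ map c [k..<l]"
      using upt_add_eq_append[of 0 k "l - k"] that(1) by simp
    then show ?thesis
      using first_passage_append_imp_Nil[of u s "map c [0..<k]" "map c [k..<l]"] that by auto
  qed
  then show ?thesis
    using assms by (metis nat_le_linear)
qed

lemma first_passage_exists_iff:
  "(\<exists>N. first_passage u s (map c [0..<N])) \<longleftrightarrow>
   (\<exists>N. s + u * count_list (map c [0..<N]) False \<le> count_list (map c [0..<N]) True)"
proof
  assume "\<exists>N. first_passage u s (map c [0..<N])"
  then show "\<exists>N. s + u * count_list (map c [0..<N]) False \<le> count_list (map c [0..<N]) True"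
    using first_passage_count_True by (metis order_refl)
next
  assume "\<exists>N. s + u * count_list (map c [0..<N]) False \<le> count_list (map c [0..<N]) True"
  then obtain N k where "k \<le> N" "first_passage u s (take k (map c [0..<N]))"
    using first_passage_prefix_exists by (metis length_map length_upt minus_nat.diff_0)
  then have "first_passage u s (map c [0..<k])"
    by (simp add: take_map)
  then show "\<exists>N. first_passage u s (map c [0..<N])" ..
qed

section \<open>The number of first passage paths\<close>

lemma first_passage_paths_0: "first_passage_paths u 0 n = (if n = 0 then {[]} else {})"
proof -
  have empty_path: "first_passage u 0 xs \<longleftrightarrow> xs = []" for xs
    by (cases xs) simp_all
  show ?thesis
    unfolding first_passage_paths_def empty_path by auto
qed

text \<open>A path with a positive height to climb is split according to its first step.\<close>

lemma first_passage_paths_Suc: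
  "first_passage_paths u (Suc s) n =
     (#) True ` first_passage_paths u s n \<union>
     (if n = 0 then {} else (#) False ` first_passage_paths u (Suc s + u) (n - 1))"
  (is "?L = ?R")
proof (rule set_eqI)
  fix xs
  show "xs \<in> ?L \<longleftrightarrow> xs \<in> ?R"
  proof (cases xs)
    case Nil
    then show ?thesis by (auto simp: first_passage_paths_def)
  next
    case (Cons x ys)
    then show ?thesis
      by (cases x; cases n) (auto simp: first_passage_paths_def image_iff)
  qed
qed

lemma finite_first_passage_paths: "finite (first_passage_paths u s n)"
proof (rule finite_subset)
  show "first_passage_paths u s n \<subseteq> {xs. set xs \<subseteq> UNIV \<and> length xs = s + u * n + n}"
    using first_passage_count_True
    by (fastforce simp: first_passage_paths_def length_eq_count_True_False)
  show "finite {xs :: bool list. set xs \<subseteq> UNIV \<and> length xs = s + u * n + n}"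
    by (rule finite_lists_length_eq) simp
qed

lemma card_first_passage_paths_Suc:
  "card (first_passage_paths u (Suc s) n) =
     card (first_passage_paths u s n) +
     (if n = 0 then 0 else card (first_passage_paths u (Suc s + u) (n - 1)))"
proof -
  have "card (first_passage_paths u (Suc s) n) =
      card ((#) True ` first_passage_paths u s n) +
      card (if n = 0 then {} else (#) False ` first_passage_paths u (Suc s + u) (n - 1))"
    unfolding first_passage_paths_Suc
    by (intro card_Un_disjoint) (auto simp: finite_first_passage_paths)
  then show ?thesis
    by (simp add: card_image)
qed

text \<open>The hitting time theorem: of all words of length \<open>L = s + n * (u + 1)\<close> with \<open>n\<close> downward steps, a
  fraction \<open>s / L\<close> consists of first passage paths. It holds because \<open>s / L * (L choose n)\<close> satisfies the
  same first step recursion as the number of paths. An upward first step leaves the parameters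
  \<open>s - 1\<close> and \<open>n\<close>, a downward one leaves \<open>s + u\<close> and \<open>n - 1\<close>; in both cases the remaining length
  is \<open>L - 1\<close>, so the recursion reduces to a relation between two adjacent binomial coefficients of
  the same row.\<close>

lemma card_first_passage_paths:
  "(s + n * Suc u) * card (first_passage_paths u s n) = s * ((s + n * Suc u) choose n)"
proof (induction n arbitrary: s)
  case 0
  have "card (first_passage_paths u s 0) = 1"
    by (induction s) (auto simp: first_passage_paths_0 card_first_passage_paths_Suc)
  then show ?case by simp
next
  case (Suc n)
  note fewer_down_steps = Suc.IH
  show ?case
  proof (induction s)
    case 0
    then show ?case by (simp add: first_passage_paths_0)
  next
    case (Suc s)
    define N where "N = s + Suc n * Suc u"
    define c1 where "c1 = int (card (first_passage_paths u s (Suc n)))"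
    define c2 where "c2 = int (card (first_passage_paths u (Suc s + u) n))"
    define X where "X = int (N choose Suc n)"
    define Y where "Y = int (N choose n)"
    have N_int: "int N = int s + (int n + 1) * (int u + 1)"
      by (simp add: N_def algebra_simps)
    have c1: "int N * c1 = int s * X"
      using Suc.IH unfolding N_def c1_def X_def by (metis of_nat_mult)
    have "N = Suc s + u + n * Suc u"
      by (simp add: N_def)
    then have c2: "int N * c2 = (int s + 1 + int u) * Y"
      using fewer_down_steps[of "Suc s + u"] unfolding c2_def Y_def
      by (metis of_nat_mult of_nat_add of_nat_Suc add.commute)
    have "Suc n * (N choose Suc n) = (N - n) * (N choose n)"
      using binomial_absorption[of n N] binomial_absorb_comp[of N n] by simp
    moreover have "n \<le> N"
      by (simp add: N_def)
    ultimately have XY: "(int n + 1) * X = (int N - int n) * Y"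
      unfolding X_def Y_def by (metis of_nat_mult of_nat_diff of_nat_Suc add.commute)
    \<comment> \<open>The common denominator \<open>N\<close> of the two induction hypotheses is kept as a factor and cancelled
      at the end.\<close>
    have "int N * ((int N + 1) * (c1 + c2)) = (int N + 1) * (int N * c1 + int N * c2)"
      by (simp add: algebra_simps)
    also have "\<dots> = (int N + 1) * (int s * X + (int s + 1 + int u) * Y)"
      by (simp only: c1 c2)
    also have "\<dots> = int N * ((int s + 1) * (X + Y))"
    proof -
      have "(int N + 1) * (int s * X + (int s + 1 + int u) * Y) - int N * ((int s + 1) * (X + Y))
          = (int s - int N) * X + (int s + 1 + (int N + 1) * int u) * Y"
        by (simp add: algebra_simps)
      also have "(int s - int N) * X = - ((int u + 1) * ((int n + 1) * X))"
        unfolding N_int by (simp add: algebra_simps)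
      also have "\<dots> = - ((int u + 1) * ((int N - int n) * Y))"
        by (simp only: XY)
      also have "\<dots> + (int s + 1 + (int N + 1) * int u) * Y
          = (int s + 1 + (int N + 1) * int u - (int u + 1) * (int N - int n)) * Y"
        by (simp add: algebra_simps)
      also have "\<dots> = 0"
        unfolding N_int by (simp add: algebra_simps)
      finally show ?thesis by simp
    qed
    finally have "int N * ((int N + 1) * (c1 + c2)) = int N * ((int s + 1) * (X + Y))" .
    moreover have "int N \<noteq> 0"
      unfolding of_nat_eq_0_iff by (simp add: N_def)
    ultimately have "(int N + 1) * (c1 + c2) = (int s + 1) * (X + Y)"
      by (simp only: mult_cancel_left) simp
    then have "int ((Suc s + Suc n * Suc u) * card (first_passage_paths u (Suc s) (Suc n))) =
        int (Suc s * ((Suc s + Suc n * Suc u) choose Suc n))"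
      by (simp add: card_first_passage_paths_Suc c1_def c2_def X_def Y_def N_def algebra_simps)
    then show ?case
      by (simp only: of_nat_eq_iff)
  qed
qed

text \<open>For \<open>s = a + 1\<close> the denominator \<open>L = n * (u + 1) + a + 1\<close> can be absorbed into the binomial
  coefficient, since \<open>(L - n) * (L choose n) = L * ((L - 1) choose n)\<close>.\<close>

lemma card_first_passage_paths_Suc_eq:
  "real (card (first_passage_paths u (Suc a) n)) =
     (real a + 1) / (real n * real u + real a + 1) * real ((n * Suc u + a) choose n)"
proof -
  define L where "L = Suc (n * Suc u + a)"
  have "L * card (first_passage_paths u (Suc a) n) = Suc a * (L choose n)"
    using card_first_passage_paths[of "Suc a" n u] by (simp add: L_def add_ac)
  moreover have "(L - n) * (L choose n) = L * ((n * Suc u + a) choose n)"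
    using binomial_absorb_comp[of L n] by (simp add: L_def)
  moreover have "L - n = Suc (n * u + a)"
    by (simp add: L_def)
  ultimately have "L * (Suc (n * u + a) * card (first_passage_paths u (Suc a) n)) =
      L * (Suc a * ((n * Suc u + a) choose n))"
    by (metis mult.left_commute)
  moreover have "L \<noteq> 0"
    by (simp add: L_def)
  ultimately have "Suc (n * u + a) * card (first_passage_paths u (Suc a) n) =
      Suc a * ((n * Suc u + a) choose n)"
    by (simp only: mult_cancel1) simp
  then have "real (Suc (n * u + a)) * real (card (first_passage_paths u (Suc a) n)) =
      real (Suc a) * real ((n * Suc u + a) choose n)"
    by (metis of_nat_mult)
  moreover have "real (Suc (n * u + a)) = real n * real u + real a + 1" "real (Suc a) = real a + 1"
    by simp_all
  ultimately have "real (card (first_passage_paths u (Suc a) n)) * (real n * real u + real a + 1) =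
      (real a + 1) * real ((n * Suc u + a) choose n)"
    by (subst mult.commute) (simp only:)
  moreover have "real n * real u + real a + 1 \<noteq> 0"
    by (simp add: add_nonneg_eq_0_iff)
  ultimately show ?thesis
    unfolding times_divide_eq_left by (intro eq_divide_imp)
qed

section \<open>The urn along a sequence of draws\<close>

lemma urn_red_eq: "urn_red r d c n = r + d * count_list (map c [0..<n]) True"
  by (induction n) auto

lemma urn_black_eq: "urn_black b d c n = b + d * count_list (map c [0..<n]) False"
  by (induction n) auto

lemma urn_red_plus_urn_black: "urn_red r d c n + urn_black b d c n = n * d + r + b"
  by (induction n) auto

lemma urn_Z_gt_iff:
  assumes "r \<ge> 1"
  shows "urn_Z r b d C n \<omega> > real u / real (Suc u) \<longleftrightarrow>
    urn_red r d (\<lambda>i. C i \<omega>) n > u * urn_black b d (\<lambda>i. C i \<omega>) n"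
proof -
  define R where "R = urn_red r d (\<lambda>i. C i \<omega>) n"
  define B where "B = urn_black b d (\<lambda>i. C i \<omega>) n"
  have total: "real (n * d + r + b) = real R + real B"
    unfolding R_def B_def by (metis urn_red_plus_urn_black of_nat_add)
  have "R \<ge> 1"
    using assms by (simp add: R_def urn_red_eq)
  then have pos: "real R + real B > 0"
    by simp
  have "urn_Z r b d C n \<omega> = real R / (real R + real B)"
    unfolding urn_Z_def urn_R_def total R_def ..
  moreover have "real u / real (Suc u) < real R / (real R + real B) \<longleftrightarrow>
      real u * (real R + real B) < real R * real (Suc u)"
    by (simp add: pos_less_divide_eq[OF pos] pos_divide_less_eq del: of_nat_Suc)
  moreover have "\<dots> \<longleftrightarrow> real u * real B < real R"
    by (simp add: algebra_simps)
  moreover have "\<dots> \<longleftrightarrow> u * B < R"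
    by (simp flip: of_nat_mult)
  ultimately show ?thesis
    by (simp add: R_def B_def)
qed

lemma urn_S_gt_iff: "urn_S r b d C \<omega> > z \<longleftrightarrow> (\<exists>n. urn_Z r b d C n \<omega> > z)"
proof -
  have "urn_Z r b d C n \<omega> \<le> 1" for n
  proof -
    have "urn_R r d C n \<omega> \<le> n * d + r + b"
      unfolding urn_R_def by (metis urn_red_plus_urn_black le_add1)
    then show ?thesis
      unfolding urn_Z_def by (intro divide_le_eq_1[THEN iffD2]) linarith
  qed
  then have "bdd_above (range (\<lambda>n. urn_Z r b d C n \<omega>))"
    by (intro bdd_aboveI[of _ 1]) auto
  then show ?thesis
    unfolding urn_S_def by (subst less_cSUP_iff) auto
qed

text \<open>The strict inequality between the numbers of balls becomes a weak one for the walk, because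
  \<open>x > m / d\<close> is equivalent to \<open>x \<ge> \<lfloor>m / d\<rfloor> + 1\<close> for integers \<open>x\<close>.\<close>

lemma urn_red_gt_iff:
  assumes "d \<ge> 1" "int a = \<lfloor>real_of_int (int b * int u - int r) / real d\<rfloor>"
  shows "urn_red r d c n > u * urn_black b d c n \<longleftrightarrow>
    Suc a + u * count_list (map c [0..<n]) False \<le> count_list (map c [0..<n]) True"
proof -
  define k where "k = count_list (map c [0..<n]) True"
  define j where "j = count_list (map c [0..<n]) False"
  define x where "x = int k - int u * int j"
  have "u * (b + d * j) < r + d * k \<longleftrightarrow> int (u * (b + d * j)) < int (r + d * k)"
    by (simp only: of_nat_less_iff)
  also have "\<dots> \<longleftrightarrow> int b * int u - int r < x * int d"
    by (simp add: x_def algebra_simps)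
  also have "\<dots> \<longleftrightarrow> real_of_int (int b * int u - int r) < real_of_int (x * int d)"
    by (simp only: of_int_less_iff)
  also have "\<dots> \<longleftrightarrow> real_of_int (int b * int u - int r) / real d < real_of_int x"
    using assms(1) by (simp add: pos_divide_less_eq)
  also have "\<dots> \<longleftrightarrow> int a < x"
    by (simp only: assms(2) floor_less_iff)
  also have "\<dots> \<longleftrightarrow> int (Suc a + u * j) \<le> int k"
    by (auto simp: x_def)
  also have "\<dots> \<longleftrightarrow> Suc a + u * j \<le> k"
    by (simp only: of_nat_le_iff)
  finally show ?thesis
    by (simp add: urn_red_eq urn_black_eq k_def j_def)
qed

section \<open>Probabilities of histories\<close>

lemma Beta_real_pos: "x > 0 \<Longrightarrow> y > 0 \<Longrightarrow> Beta x y > (0 :: real)"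
  unfolding Beta_def by (intro divide_pos_pos mult_pos_pos Gamma_real_pos add_pos_pos)

context polya_urn
begin

lemma history_measurable: "{\<omega> \<in> space M. \<forall>i<n. C i \<omega> = c i} \<in> sets M"
proof -
  have [measurable]: "C i \<in> measurable M (count_space UNIV)" for i
    by (rule measurable_colour)
  show ?thesis
    by measurable
qed

text \<open>Exchangeability: drawing one more red ball multiplies the probability by \<open>x / (x + y)\<close>, where
  \<open>x\<close> and \<open>y\<close> are the present numbers of red and black balls divided by \<open>d\<close>. This is also the
  quotient of \<open>Beta (x + 1) y\<close> and \<open>Beta x y\<close>; a black draw is analogous.\<close>

lemma prob_history_eq_Beta_quotient:
  assumes pos: "r \<ge> 1" "b \<ge> 1" "d \<ge> 1"
  shows "\<P>(\<omega> in M. \<forall>i<n. C i \<omega> = c i) =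
    Beta (real (count_list (map c [0..<n]) True) + real r / real d)
         (real (count_list (map c [0..<n]) False) + real b / real d)
      / Beta (real r / real d) (real b / real d)"
proof (induction n)
  case 0
  have "Beta (real r / real d) (real b / real d) > 0"
    using pos by (intro Beta_real_pos) auto
  then show ?case
    by (simp add: prob_space)
next
  case (Suc n)
  define x where "x = real (count_list (map c [0..<n]) True) + real r / real d"
  define y where "y = real (count_list (map c [0..<n]) False) + real b / real d"
  define W where "W = Beta (real r / real d) (real b / real d)"
  define p where "p = \<P>(\<omega> in M. \<forall>i<n. C i \<omega> = c i)"
  define q where "q = real (urn_red r d c n) / real (urn_red r d c n + urn_black b d c n)"
  have x: "x > 0" and y: "y > 0"
    using pos by (simp_all add: x_def y_def add_nonneg_pos)
  have p: "p = Beta x y / W"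
    using Suc.IH by (simp add: p_def x_def y_def W_def)
  have p_pos: "p > 0"
    unfolding p W_def using pos x y by (intro divide_pos_pos Beta_real_pos) auto
  have red: "real (urn_red r d c n) = real d * x" and black: "real (urn_black b d c n) = real d * y"
    using pos by (simp_all add: urn_red_eq urn_black_eq x_def y_def field_simps)
  have q: "q = x / (x + y)"
    using pos by (simp add: q_def red black flip: distrib_left)
  have red_draw: "\<P>(\<omega> in M. C n \<omega> \<and> (\<forall>i<n. C i \<omega> = c i)) = q * p"
    using uniform_draw[of n c] p_pos by (simp add: cond_prob_def p_def q_def field_simps)
  have "x \<notin> \<int>\<^sub>\<le>\<^sub>0" "y \<notin> \<int>\<^sub>\<le>\<^sub>0"
    using x y nonpos_Ints_nonpos[of x] nonpos_Ints_nonpos[of y] by auto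
  note Beta_plus1 = Beta_plus1_left[OF this(1), of y] Beta_plus1_right[OF this(2), of x]
  have Beta_red: "Beta (x + 1) y = Beta x y * (x / (x + y))"
    using Beta_plus1(1) x y by (simp add: field_simps)
  have Beta_black: "Beta x (y + 1) = Beta x y * (y / (x + y))"
    using Beta_plus1(2) x y by (simp add: field_simps)
  show ?case
  proof (cases "c n")
    case True
    have "{\<omega> \<in> space M. \<forall>i<Suc n. C i \<omega> = c i} = {\<omega> \<in> space M. C n \<omega> \<and> (\<forall>i<n. C i \<omega> = c i)}"
      using True by (auto simp: less_Suc_eq)
    then have "\<P>(\<omega> in M. \<forall>i<Suc n. C i \<omega> = c i) = q * p"
      using red_draw by simp
    also have "\<dots> = Beta (x + 1) y / W"
      by (simp add: p q Beta_red)
    finally show ?thesis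
      using True by (simp add: x_def y_def W_def add_ac)
  next
    case False
    have measurable: "{\<omega> \<in> space M. C n \<omega> \<and> (\<forall>i<n. C i \<omega> = c i)} \<in> sets M"
      using history_measurable[of "Suc n" "c(n := True)"]
      by (rule back_subst[where P = "\<lambda>A. A \<in> sets M"]) (auto simp: less_Suc_eq)
    have "{\<omega> \<in> space M. \<forall>i<Suc n. C i \<omega> = c i} =
        {\<omega> \<in> space M. \<forall>i<n. C i \<omega> = c i} - {\<omega> \<in> space M. C n \<omega> \<and> (\<forall>i<n. C i \<omega> = c i)}"
      using False by (auto simp: less_Suc_eq)
    then have "\<P>(\<omega> in M. \<forall>i<Suc n. C i \<omega> = c i) = p - q * p"
      using finite_measure_Diff[OF history_measurable[of n c] measurable] red_draw
      by (auto simp: p_def)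
    also have "\<dots> = p * (y / (x + y))"
      using x y by (simp add: q field_simps)
    also have "\<dots> = Beta x (y + 1) / W"
      by (simp add: p Beta_black)
    finally show ?thesis
      using False by (simp add: x_def y_def W_def add_ac)
  qed
qed

text \<open>The event is split by the number \<open>n\<close> of black draws before the first passage and then into
  cylinders, all of which have the same probability for a given \<open>n\<close>.\<close>

lemma prob_first_passage_sums:
  assumes pos: "r \<ge> 1" "b \<ge> 1" "d \<ge> 1"
  shows "(\<lambda>n. real (card (first_passage_paths u s n)) *
      (Beta (real (s + u * n) + real r / real d) (real n + real b / real d)
        / Beta (real r / real d) (real b / real d)))
    sums \<P>(\<omega> in M. \<exists>N. first_passage u s (map (\<lambda>i. C i \<omega>) [0..<N]))"
proof -
  define cyl where "cyl xs = {\<omega> \<in> space M. \<forall>i<length xs. C i \<omega> = xs ! i}" for xs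
  define A where "A n = (\<Union>xs\<in>first_passage_paths u s n. cyl xs)" for n
  have cyl_iff: "\<omega> \<in> cyl xs \<longleftrightarrow> \<omega> \<in> space M \<and> map (\<lambda>i. C i \<omega>) [0..<length xs] = xs" for \<omega> xs
    unfolding cyl_def by (subst list_eq_iff_nth_eq) auto
  have cyl_sets: "cyl xs \<in> sets M" for xs
    unfolding cyl_def by (rule history_measurable)
  have cyl_unique: "xs = ys"
    if \<omega>: "\<omega> \<in> cyl xs" "\<omega> \<in> cyl ys" and fp: "first_passage u s xs" "first_passage u s ys"
    for \<omega> xs ys
  proof -
    have xs: "map (\<lambda>i. C i \<omega>) [0..<length xs] = xs" and ys: "map (\<lambda>i. C i \<omega>) [0..<length ys] = ys"
      using \<omega> unfolding cyl_iff by blast+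
    have "first_passage u s (map (\<lambda>i. C i \<omega>) [0..<length xs])"
      unfolding xs by (rule fp(1))
    moreover have "first_passage u s (map (\<lambda>i. C i \<omega>) [0..<length ys])"
      unfolding ys by (rule fp(2))
    ultimately have "length xs = length ys"
      by (rule first_passage_along_sequence_unique)
    then have "map (\<lambda>i. C i \<omega>) [0..<length xs] = map (\<lambda>i. C i \<omega>) [0..<length ys]"
      by (rule arg_cong)
    then show ?thesis
      unfolding xs ys .
  qed
  have "A n \<in> sets M" for n
    unfolding A_def by (intro sets.finite_UN finite_first_passage_paths cyl_sets)
  then have A_sets: "range A \<subseteq> sets M"
    by blast
  have "A n \<inter> A k = {}" if "n \<noteq> k" for n k
  proof (rule equals0I)
    fix \<omega> assume "\<omega> \<in> A n \<inter> A k"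
    then obtain xs ys where paths: "xs \<in> first_passage_paths u s n" "ys \<in> first_passage_paths u s k"
      and \<omega>: "\<omega> \<in> cyl xs" "\<omega> \<in> cyl ys"
      unfolding A_def by blast
    from paths have "xs = ys"
      unfolding first_passage_paths_def by (intro cyl_unique[OF \<omega>]) blast+
    then show False
      using paths \<open>n \<noteq> k\<close> by (simp add: first_passage_paths_def)
  qed
  then have "disjoint_family A"
    by (simp add: disjoint_family_on_def)
  from finite_measure_UNION[OF A_sets this]
  have "(\<lambda>n. prob (A n)) sums prob (\<Union>n. A n)" .
  moreover have "(\<Union>n. A n) = {\<omega> \<in> space M. \<exists>N. first_passage u s (map (\<lambda>i. C i \<omega>) [0..<N])}"
  proof (intro set_eqI iffI)
    fix \<omega> assume "\<omega> \<in> (\<Union>n. A n)"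
    then obtain xs where fp: "first_passage u s xs" and \<omega>: "\<omega> \<in> cyl xs"
      by (auto simp: A_def first_passage_paths_def)
    have "first_passage u s (map (\<lambda>i. C i \<omega>) [0..<length xs])"
      using fp \<omega>[unfolded cyl_iff] by (simp only:)
    then show "\<omega> \<in> {\<omega> \<in> space M. \<exists>N. first_passage u s (map (\<lambda>i. C i \<omega>) [0..<N])}"
      using \<omega>[unfolded cyl_iff] by blast
  next
    fix \<omega> assume "\<omega> \<in> {\<omega> \<in> space M. \<exists>N. first_passage u s (map (\<lambda>i. C i \<omega>) [0..<N])}"
    then obtain N where "\<omega> \<in> space M" and fp: "first_passage u s (map (\<lambda>i. C i \<omega>) [0..<N])"
      by blast
    then have "\<omega> \<in> cyl (map (\<lambda>i. C i \<omega>) [0..<N])"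
      by (simp add: cyl_def)
    then show "\<omega> \<in> (\<Union>n. A n)"
      using fp unfolding A_def first_passage_paths_def by blast
  qed
  moreover have "prob (A n) = real (card (first_passage_paths u s n)) *
      (Beta (real (s + u * n) + real r / real d) (real n + real b / real d)
        / Beta (real r / real d) (real b / real d))" for n
  proof -
    have "prob (A n) = (\<Sum>xs\<in>first_passage_paths u s n. prob (cyl xs))"
      unfolding A_def
    proof (rule finite_measure_finite_Union)
      show "finite (first_passage_paths u s n)"
        by (rule finite_first_passage_paths)
      show "cyl ` first_passage_paths u s n \<subseteq> sets M"
        using cyl_sets by blast
      show "disjoint_family_on cyl (first_passage_paths u s n)"
        unfolding disjoint_family_on_def first_passage_paths_def
        using cyl_unique by blast
    qed
    also have "\<dots> = (\<Sum>xs\<in>first_passage_paths u s n.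
        Beta (real (s + u * n) + real r / real d) (real n + real b / real d)
          / Beta (real r / real d) (real b / real d))"
    proof (rule sum.cong[OF refl])
      fix xs assume "xs \<in> first_passage_paths u s n"
      then have "count_list xs False = n" "count_list xs True = s + u * n"
        using first_passage_count_True[of u s xs] by (auto simp: first_passage_paths_def)
      then show "prob (cyl xs) =
          Beta (real (s + u * n) + real r / real d) (real n + real b / real d)
            / Beta (real r / real d) (real b / real d)"
        using prob_history_eq_Beta_quotient[OF pos, of "length xs" "\<lambda>i. xs ! i"]
        by (simp only: cyl_def map_nth)
    qed
    finally show ?thesis
      by simp
  qed
  ultimately show ?thesis
    by simp
qed

end

section \<open>The supremum of the proportions\<close>

theorem proposition5p1:
  fixes M :: "'a measure" and C :: "nat \<Rightarrow> 'a \<Rightarrow> bool" and r b d t a :: nat and m :: int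
  assumes "polya_urn M C r b d"
    and "r \<ge> 1" and "b \<ge> 1" and "d \<ge> 1" and "t \<ge> 2"
    and "m = int b * (int t - 1) - int r" and "m \<ge> 0"
    and "int a = \<lfloor>real_of_int m / real d\<rfloor>"
  shows "(\<lambda>n. (real a + 1) / (real n * (real t - 1) + real a + 1) * real ((n * t + a) choose n)
            * (Beta (real n * (real t - 1) + real a + 1 + real r / real d) (real n + real b / real d)
               / Beta (real r / real d) (real b / real d)))
         sums \<P>(\<omega> in M. urn_S r b d C \<omega> > (real t - 1) / real t)"
proof -
  interpret polya_urn M C r b d by fact
  from \<open>t \<ge> 2\<close> obtain u where t: "t = Suc u"
    by (cases t) auto
  have a: "int a = \<lfloor>real_of_int (int b * int u - int r) / real d\<rfloor>"
    using assms(6,8) by (simp add: t)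
  have "urn_S r b d C \<omega> > (real t - 1) / real t \<longleftrightarrow>
      (\<exists>N. first_passage u (Suc a) (map (\<lambda>i. C i \<omega>) [0..<N]))" for \<omega>
    using urn_Z_gt_iff[OF \<open>r \<ge> 1\<close>, of u b d C _ \<omega>]
    by (simp add: t urn_S_gt_iff first_passage_exists_iff urn_red_gt_iff[OF \<open>d \<ge> 1\<close> a])
  moreover have "real (Suc a + u * n) = real n * (real t - 1) + real a + 1" for n
    by (simp add: t)
  moreover have "real (card (first_passage_paths u (Suc a) n)) =
      (real a + 1) / (real n * (real t - 1) + real a + 1) * real ((n * t + a) choose n)" for n
    unfolding card_first_passage_paths_Suc_eq by (simp add: t)
  ultimately show ?thesis
    using prob_first_passage_sums[OF \<open>r \<ge> 1\<close> \<open>b \<ge> 1\<close> \<open>d \<ge> 1\<close>, of u "Suc a"] by (simp only:)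
qed

end
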